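(* Let $b,d,t$ be independent indeterminates over $\mathbb{Q}$, and define $(d_n)_{n\ge 1}$ in $\mathbb{Q}(b,d,t)$ by $d_1=b$, $d_2=d$ and $$d_n=\frac{1}{d_{n-1}d_{n-2}}\quad(n\ge 3\text{ odd}),\qquad d_n=\frac{t}{d_{n-2}}+d_{n-3}\quad(n\ge 4\text{ even}).$$ Let $T=T(x)\in\mathbb{Q}(b,d,t)[[x]]$ be the formal continued fraction $$T(x)=\cfrac{1}{1-\cfrac{d_1x}{1-\cfrac{d_2x}{1-\ddots}}}.$$ Then $T(0)=1$ and $$\mathcal{A}(x)T^2+\mathcal{B}(x)T+\mathcal{C}(x)=0,$$ where $$\begin{aligned} \mathcal{A}(x)&=(bt+1)x-b\bigl((b+d)t+1\bigr)x^2,\\ \mathcal{B}(x)&=bdt\,x^2+\bigl(-bt+b^2d+d^2b-1\bigr)x-bd,\\ \mathcal{C}(x)&=bd-bd^2x. \end{aligned}$$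
   Context: The infinite continued fraction is understood as a formal power series in $x$, i.e. as the $x$-adic limit of its finite truncations. *)

theory Defs
  imports "HOL-Computational_Algebra.Computational_Algebra"
begin

text \<open>
  The field \<open>\<rat>(b,d,t)\<close> is the fraction field of \<open>\<rat>[b][d][t]\<close>.
\<close>

type_synonym ratfun3 = "rat poly poly poly fract"

definition ind_b :: ratfun3 where "ind_b = to_fract [:[:[:0, 1:]:]:]"
definition ind_d :: ratfun3 where "ind_d = to_fract [:[:0, 1:]:]"
definition ind_t :: ratfun3 where "ind_t = to_fract [:0, 1:]"

text \<open>The index \<open>0\<close> is not used; its value is arbitrary.\<close>

fun dseq :: "nat \<Rightarrow> ratfun3" where
  "dseq n =
    (if n = 0 then 0
     else if n = 1 then ind_b
     else if n = 2 then ind_d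
     else if odd n then 1 / (dseq (n - 1) * dseq (n - 2))
     else ind_t / dseq (n - 2) + dseq (n - 3))"

declare dseq.simps [simp del]

lemma dseq_1: "dseq 1 = ind_b"
  and dseq_2: "dseq 2 = ind_d"
  by (subst dseq.simps, simp)+

lemma dseq_odd: "n \<ge> 3 \<Longrightarrow> odd n \<Longrightarrow> dseq n = 1 / (dseq (n - 1) * dseq (n - 2))"
  by (subst dseq.simps) auto

lemma dseq_even: "n \<ge> 4 \<Longrightarrow> even n \<Longrightarrow> dseq n = ind_t / dseq (n - 2) + dseq (n - 3)"
  by (subst dseq.simps) auto

text \<open>
  \<open>cfrac_den c k m\<close> is the power series
  \<open>1 - c k x / (1 - c (k+1) x / (\<dots> / (1 - c (k+m-1) x)))\<close>.
\<close>

fun cfrac_den :: "(nat \<Rightarrow> 'a :: field) \<Rightarrow> nat \<Rightarrow> nat \<Rightarrow> 'a fps" where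
  "cfrac_den c k 0 = 1"
| "cfrac_den c k (Suc m) = 1 - fps_const (c k) * fps_X / cfrac_den c (Suc k) m"

definition cfrac_trunc :: "(nat \<Rightarrow> 'a :: field) \<Rightarrow> nat \<Rightarrow> 'a fps" where
  "cfrac_trunc c m = 1 / cfrac_den c 1 m"

text \<open>
  The topology on power series is the \<open>x\<close>-adic one (distinct series whose difference has order
  \<open>n\<close> are at distance \<open>2\<^sup>-\<^sup>n\<close>); \<open>cfrac_trunc_LIMSEQ\<close> below shows that the limit exists.
\<close>

definition cfrac :: "(nat \<Rightarrow> 'a :: field) \<Rightarrow> 'a fps" where
  "cfrac c = lim (cfrac_trunc c)"


subsection \<open>Well-definedness: every truncation is a genuine fraction and the limit exists\<close>

lemma fps_inverse_nth_cong:
  fixes f g :: "'a :: field fps"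
  assumes "\<And>i. i \<le> n \<Longrightarrow> fps_nth f i = fps_nth g i" "fps_nth f 0 \<noteq> 0"
  shows "fps_nth (inverse f) n = fps_nth (inverse g) n"
proof -
  have f: "inverse f * f = 1" and g: "inverse g * g = 1"
    using assms(1)[of 0] assms(2) by (simp_all add: inverse_mult_eq_1)
  have "inverse f - inverse g = inverse f * (inverse g * g) - inverse g * (inverse f * f)"
    by (simp add: f g)
  also have "\<dots> = (g - f) * (inverse f * inverse g)"
    by (simp add: algebra_simps)
  finally have "fps_nth (inverse f - inverse g) n =
      fps_nth ((g - f) * (inverse f * inverse g)) n"
    by simp
  also have "\<dots> = (\<Sum>i=0..n. fps_nth (g - f) i * fps_nth (inverse f * inverse g) (n - i))"
    by (rule fps_mult_nth)
  also have "\<dots> = 0"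
    by (rule sum.neutral) (simp add: assms(1))
  finally show ?thesis by simp
qed

lemma cfrac_den_nth_0 [simp]: "fps_nth (cfrac_den c k m) 0 = 1"
proof (induction m arbitrary: k)
  case (Suc m)
  then have "fps_nth (cfrac_den c (Suc k) m) 0 \<noteq> 0"
    by simp
  then show ?case
    by (simp add: fps_divide_unit)
qed simp

lemma cfrac_den_Suc_nth:
  "fps_nth (cfrac_den c k (Suc m)) j =
     (if j = 0 then 1 else - c k * fps_nth (inverse (cfrac_den c (Suc k) m)) (j - 1))"
  by (simp add: fps_divide_unit mult.assoc)

lemma cfrac_den_nth_stable:
  "j \<le> m \<Longrightarrow> fps_nth (cfrac_den c k (Suc m)) j = fps_nth (cfrac_den c k m) j"
proof (induction m arbitrary: k j)
  case 0
  then show ?case by (simp add: cfrac_den_Suc_nth del: cfrac_den.simps(2))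
next
  case (Suc m)
  show ?case
  proof (cases j)
    case (Suc i)
    have "fps_nth (inverse (cfrac_den c (Suc k) (Suc m))) i =
          fps_nth (inverse (cfrac_den c (Suc k) m)) i"
      by (rule fps_inverse_nth_cong)
         (use Suc.IH Suc.prems Suc in \<open>auto simp del: cfrac_den.simps(2)\<close>)
    then show ?thesis
      unfolding cfrac_den_Suc_nth using Suc by simp
  qed (simp del: cfrac_den.simps(2))
qed

lemma cfrac_trunc_nth_stable:
  assumes "j \<le> m"
  shows "fps_nth (cfrac_trunc c m) j = fps_nth (cfrac_trunc c j) j"
  using assms
proof (induction m rule: dec_induct)
  case (step m)
  have "fps_nth (inverse (cfrac_den c 1 (Suc m))) j = fps_nth (inverse (cfrac_den c 1 m)) j"
    by (rule fps_inverse_nth_cong)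
       (use step cfrac_den_nth_stable[of _ m c 1] in \<open>auto simp del: cfrac_den.simps(2)\<close>)
  with step.IH show ?case
    by (simp add: cfrac_trunc_def fps_divide_unit del: cfrac_den.simps(2))
qed simp

lemma cfrac_trunc_LIMSEQ: "cfrac_trunc c \<longlonglongrightarrow> cfrac c"
proof -
  have "cfrac_trunc c \<longlonglongrightarrow> Abs_fps (\<lambda>j. fps_nth (cfrac_trunc c j) j)"
  proof (rule tendsto_fpsI)
    fix j
    show "\<forall>\<^sub>F m in sequentially. fps_nth (cfrac_trunc c m) j =
            fps_nth (Abs_fps (\<lambda>j. fps_nth (cfrac_trunc c j) j)) j"
      using eventually_ge_at_top[of j]
      by eventually_elim (metis cfrac_trunc_nth_stable fps_nth_Abs_fps)
  qed
  then show ?thesis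
    unfolding cfrac_def by (simp add: limI)
qed


subsection \<open>Well-definedness: no division by zero occurs in the recurrence\<close>

definition eval_at_1 :: "rat poly poly poly \<Rightarrow> rat" where
  "eval_at_1 p = poly (poly (poly p 1) 1) 1"

lemma eval_at_1_simps [simp]:
  "eval_at_1 0 = 0" "eval_at_1 1 = 1"
  "eval_at_1 (p + q) = eval_at_1 p + eval_at_1 q"
  "eval_at_1 (p * q) = eval_at_1 p * eval_at_1 q"
  by (simp_all add: eval_at_1_def)

definition pos_at_1 :: "ratfun3 \<Rightarrow> bool" where
  "pos_at_1 x \<longleftrightarrow>
     (\<exists>p q. x = to_fract p / to_fract q \<and> eval_at_1 p > 0 \<and> eval_at_1 q > 0)"

lemma eval_at_1_pos_imp_nz: "eval_at_1 p > 0 \<Longrightarrow> to_fract p \<noteq> 0"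
  by auto

lemma pos_at_1_nz: "pos_at_1 x \<Longrightarrow> x \<noteq> 0"
  by (auto simp: pos_at_1_def)

lemma pos_at_1_to_fract: "eval_at_1 p > 0 \<Longrightarrow> pos_at_1 (to_fract p)"
  unfolding pos_at_1_def by (intro exI[of _ p] exI[of _ 1]) simp

lemma pos_at_1_ind: "pos_at_1 ind_b" "pos_at_1 ind_d" "pos_at_1 ind_t" "pos_at_1 1"
  using pos_at_1_to_fract[of 1]
  by (auto simp: ind_b_def ind_d_def ind_t_def eval_at_1_def intro!: pos_at_1_to_fract)

lemma pos_at_1_add:
  assumes "pos_at_1 x" "pos_at_1 y"
  shows "pos_at_1 (x + y)"
proof -
  obtain p q r s where *: "x = to_fract p / to_fract q" "y = to_fract r / to_fract s"
    "eval_at_1 p > 0" "eval_at_1 q > 0" "eval_at_1 r > 0" "eval_at_1 s > 0"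
    using assms unfolding pos_at_1_def by blast
  then have "x + y = to_fract (p * s + r * q) / to_fract (q * s)"
    using eval_at_1_pos_imp_nz[of q] eval_at_1_pos_imp_nz[of s] by (simp add: add_frac_eq)
  with * show ?thesis
    unfolding pos_at_1_def by (intro exI[of _ "p * s + r * q"] exI[of _ "q * s"]) (simp add: add_pos_pos)
qed

lemma pos_at_1_mult:
  assumes "pos_at_1 x" "pos_at_1 y"
  shows "pos_at_1 (x * y)"
proof -
  obtain p q r s where *: "x = to_fract p / to_fract q" "y = to_fract r / to_fract s"
    "eval_at_1 p > 0" "eval_at_1 q > 0" "eval_at_1 r > 0" "eval_at_1 s > 0"
    using assms unfolding pos_at_1_def by blast
  then show ?thesis
    unfolding pos_at_1_def by (intro exI[of _ "p * r"] exI[of _ "q * s"]) simp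
qed

lemma pos_at_1_divide:
  assumes "pos_at_1 x" "pos_at_1 y"
  shows "pos_at_1 (x / y)"
proof -
  obtain r s where "y = to_fract r / to_fract s" "eval_at_1 r > 0" "eval_at_1 s > 0"
    using assms unfolding pos_at_1_def by blast
  then have "pos_at_1 (inverse y)"
    unfolding pos_at_1_def by (intro exI[of _ s] exI[of _ r]) simp
  with assms(1) show ?thesis
    by (simp add: divide_inverse pos_at_1_mult)
qed

lemma dseq_nonzero:
  assumes "n \<ge> 1"
  shows "dseq n \<noteq> 0"
proof -
  have "pos_at_1 (dseq n)"
    using assms
  proof (induction n rule: less_induct)
    case (less n)
    consider "n = 1" | "n = 2" | "n \<ge> 3" "odd n" | "n \<ge> 4" "even n"
      using less.prems by (cases "n = 3"; fastforce)
    then show ?case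
    proof cases
      case 1
      then show ?thesis using dseq_1 pos_at_1_ind(1) by simp
    next
      case 2
      then show ?thesis by (simp add: dseq_2 pos_at_1_ind)
    next
      case 3
      then have "pos_at_1 (dseq (n - 1))" "pos_at_1 (dseq (n - 2))"
        using less.IH by simp_all
      then show ?thesis
        unfolding dseq_odd[OF 3] by (intro pos_at_1_divide pos_at_1_mult pos_at_1_ind)
    next
      case 4
      then have "pos_at_1 (dseq (n - 2))" "pos_at_1 (dseq (n - 3))"
        using less.IH by simp_all
      then show ?thesis
        unfolding dseq_even[OF 4] by (intro pos_at_1_divide pos_at_1_add pos_at_1_ind)
    qed
  qed
  then show ?thesis by (rule pos_at_1_nz)
qed

end

theory Submission
  imports Defs
begin

text \<open>
  The recurrence reaches only a bounded number of steps back and depends only on parity, so the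
  shifted sequence \<open>d\<^sub>3, d\<^sub>4, d\<^sub>5, \<dots>\<close> obeys the same recurrence as \<open>d\<^sub>1, d\<^sub>2, d\<^sub>3, \<dots>\<close>, with the
  initial values \<open>b, d\<close> replaced by \<open>b' = 1 / (b d)\<close> and \<open>d' = t / d + b\<close>. Its continued fraction
  \<open>T'\<close> should therefore satisfy the quadratic equation with \<open>b', d'\<close> in place of \<open>b, d\<close>. On the
  other hand, \<open>T\<close> is the fractional linear transform \<open>T = (1 - d x T') / (1 - b x - d x T')\<close> of
  \<open>T'\<close> (lemma \<open>cfrac_unfold_twice\<close>). Write \<open>Q\<close> and \<open>Q'\<close> for the left-hand sides of the equations
  for \<open>T\<close> and \<open>T'\<close>. Inserting the transform into \<open>Q\<close> and clearing denominators gives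

  \<open>d' (1 - b x - d x T')\<^sup>2 Q = (b d)\<^sup>3 x\<^sup>2 Q'\<close>

  (lemma \<open>quadratic_shift\<close>): the family of quadratics is reproduced, and an additional factor
  \<open>x\<^sup>2\<close> appears. This replaces the missing start of an induction along the infinite fraction.
  Since \<open>d' (1 - b x - d x T')\<^sup>2\<close> is a unit among the power series, iterating the identity shows
  that \<open>Q\<close> is divisible by every power of \<open>x\<close> (lemma \<open>X_power_dvd_quadratic_cfrac\<close>), hence
  \<open>Q = 0\<close>.
\<close>

lemma fps_nth_cfrac:
  assumes "j \<le> m"
  shows "fps_nth (cfrac c) j = fps_nth (cfrac_trunc c m) j"
proof -
  have "\<forall>\<^sub>F n in sequentially. fps_nth (cfrac_trunc c n) j = fps_nth (cfrac c) j"
    using cfrac_trunc_LIMSEQ[of c] by (simp add: tendsto_fps_iff)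
  then obtain N where "\<And>n. n \<ge> N \<Longrightarrow> fps_nth (cfrac_trunc c n) j = fps_nth (cfrac c) j"
    by (auto simp: eventually_sequentially)
  from this[of "max N m"] show ?thesis
    using cfrac_trunc_nth_stable[of j "max N m" c] cfrac_trunc_nth_stable[of j m c] assms
    by simp
qed

lemma fps_nth_cfrac_0: "fps_nth (cfrac c) 0 = 1"
  by (simp add: fps_nth_cfrac[of 0 0] cfrac_trunc_def)

lemma cfrac_den_shift: "cfrac_den (\<lambda>n. c (Suc n)) k m = cfrac_den c (Suc k) m"
  by (induction m arbitrary: k) simp_all

text \<open>
  The identity holds for the truncations, and the coefficient of \<open>x\<^sup>n\<close> on either
  side involves only coefficients of index at most \<open>n\<close>, which the truncations determine.
\<close>

lemma cfrac_unfold: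
  "cfrac c * (1 - fps_const (c 1) * fps_X * cfrac (\<lambda>n. c (Suc n))) = 1"
proof (rule fps_ext)
  fix n
  have trunc: "cfrac_trunc c (Suc n) *
      (1 - fps_const (c 1) * fps_X * cfrac_trunc (\<lambda>n. c (Suc n)) n) = 1"
  proof -
    have "1 - fps_const (c 1) * fps_X * cfrac_trunc (\<lambda>n. c (Suc n)) n = cfrac_den c 1 (Suc n)"
      by (simp add: cfrac_trunc_def cfrac_den_shift fps_divide_unit)
    moreover have "cfrac_trunc c (Suc n) * cfrac_den c 1 (Suc n) = 1"
      by (simp add: cfrac_trunc_def fps_divide_unit inverse_mult_eq_1 del: cfrac_den.simps)
    ultimately show ?thesis by simp
  qed
  have "fps_nth (1 - fps_const (c 1) * fps_X * cfrac (\<lambda>n. c (Suc n))) i =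
      fps_nth (1 - fps_const (c 1) * fps_X * cfrac_trunc (\<lambda>n. c (Suc n)) n) i" if "i \<le> n" for i
    using that by (simp add: mult.assoc fps_nth_cfrac[of _ n])
  then have "fps_nth (cfrac c * (1 - fps_const (c 1) * fps_X * cfrac (\<lambda>n. c (Suc n)))) n =
      fps_nth (cfrac_trunc c (Suc n) *
        (1 - fps_const (c 1) * fps_X * cfrac_trunc (\<lambda>n. c (Suc n)) n)) n"
    unfolding fps_mult_nth
    by (intro sum.cong refl arg_cong2[where f = "(*)"] fps_nth_cfrac) auto
  with trunc show "fps_nth (cfrac c * (1 - fps_const (c 1) * fps_X * cfrac (\<lambda>n. c (Suc n)))) n =
      fps_nth 1 n" by simp
qed

lemma cfrac_unfold_twice:
  "cfrac c * (1 - fps_const (c 1) * fps_X - fps_const (c 2) * fps_X * cfrac (\<lambda>n. c (n + 2))) =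
     1 - fps_const (c 2) * fps_X * cfrac (\<lambda>n. c (n + 2))"
proof -
  define S where "S = cfrac (\<lambda>n. c (Suc n))"
  define V where "V = 1 - fps_const (c 2) * fps_X * cfrac (\<lambda>n. c (n + 2))"
  have T: "cfrac c * (1 - fps_const (c 1) * fps_X * S) = 1"
    unfolding S_def by (rule cfrac_unfold)
  have S: "S * V = 1"
    using cfrac_unfold[of "\<lambda>n. c (Suc n)"] by (simp add: S_def V_def numeral_2_eq_2)
  have "cfrac c * (V - fps_const (c 1) * fps_X) =
      cfrac c * (V - fps_const (c 1) * fps_X * (S * V))"
    by (simp add: S)
  also have "\<dots> = cfrac c * (1 - fps_const (c 1) * fps_X * S) * V"
    by (simp add: algebra_simps)
  also have "\<dots> = V" by (simp only: T mult_1)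
  finally show ?thesis by (simp add: V_def algebra_simps)
qed

definition quadratic :: "'a :: comm_ring_1 \<Rightarrow> 'a \<Rightarrow> 'a \<Rightarrow> 'a \<Rightarrow> 'a \<Rightarrow> 'a" where
  "quadratic b d t x T =
     ((b * t + 1) * x - b * ((b + d) * t + 1) * x ^ 2) * T ^ 2 +
     (b * d * t * x ^ 2 + (- b * t + b ^ 2 * d + d ^ 2 * b - 1) * x - b * d) * T +
     (b * d - b * d ^ 2 * x)"

text \<open>
  Let \<open>A, B, C\<close> be the coefficients of the quadratic in \<open>T\<close>. Multiplying \<open>A T\<^sup>2 + B T + C\<close> by
  \<open>(1 - b x - d x T')\<^sup>2\<close> gives a quadratic in \<open>T'\<close> with coefficients
  \<open>d\<^sup>2 x\<^sup>2 (A + B + C)\<close>, \<open>- d x (2 A + (2 - b x) B + 2 (1 - b x) C)\<close> and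
  \<open>A + (1 - b x) B + (1 - b x)\<^sup>2 C\<close>. All three are divisible by \<open>x\<^sup>2\<close>: the terms without \<open>x\<close>
  cancel in the second bracket, and the terms of degree \<open>0\<close> and \<open>1\<close> in \<open>x\<close> cancel in the last
  coefficient.
\<close>

lemma quadratic_shift:
  fixes b d t x T b' d' T' :: "'a :: comm_ring_1"
  assumes "b' * (b * d) = 1" and "d * d' = t + b * d"
    and "T * (1 - b * x - d * x * T') = 1 - d * x * T'"
  shows "d' * (1 - b * x - d * x * T') ^ 2 * quadratic b d t x T =
    (b * d) ^ 3 * x ^ 2 * quadratic b' d' t x T'"
proof -
  define e where "e = b * d"
  define M where "M = 1 - d * x * T'"
  define N where "N = 1 - b * x - d * x * T'"
  have eb: "e * b' = 1" and TN: "T * N = M"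
    using assms(1,3) by (simp_all add: e_def M_def N_def mult.commute)
  have t: "t = d * d' - b * d" using assms(2) by simp
  \<comment> \<open>\<open>b'\<close> occurs in the shifted quadratic with degree \<open>2\<close> at most, so the factor \<open>e\<^sup>2\<close> eliminates it.\<close>
  define P where "P = ((e * t + e ^ 2) * x - (t + e * d' * t + e) * x ^ 2) * T' ^ 2 +
     (e * d' * t * x ^ 2 + (- e * t + d' + d' ^ 2 * e - e ^ 2) * x - e * d') * T' +
     (e * d' - e * d' ^ 2 * x)"
  have eb1: "e ^ 2 * b' = e" and eb2: "e ^ 2 * b' ^ 2 = 1"
    using eb by (simp_all add: power2_eq_square mult.assoc flip: power_mult_distrib)
      (metis eb mult.left_commute mult_1_right)
  have "e ^ 2 * quadratic b' d' t x T' =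
     ((e ^ 2 * b' * t + e ^ 2) * x -
       (e ^ 2 * b' ^ 2 * t + e ^ 2 * b' * d' * t + e ^ 2 * b') * x ^ 2) * T' ^ 2 +
     (e ^ 2 * b' * d' * t * x ^ 2 +
       (- (e ^ 2 * b') * t + e ^ 2 * b' ^ 2 * d' + d' ^ 2 * (e ^ 2 * b') - e ^ 2) * x -
       e ^ 2 * b' * d') * T' +
     (e ^ 2 * b' * d' - e ^ 2 * b' * d' ^ 2 * x)"
    unfolding quadratic_def by (simp add: algebra_simps power2_eq_square)
  then have P: "e ^ 2 * quadratic b' d' t x T' = P"
    unfolding eb1 eb2 P_def by simp
  have "N ^ 2 * quadratic b d t x T =
     ((b * t + 1) * x - b * ((b + d) * t + 1) * x ^ 2) * (T * N) ^ 2 +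
     (b * d * t * x ^ 2 + (- b * t + b ^ 2 * d + d ^ 2 * b - 1) * x - b * d) * (T * N) * N +
     (b * d - b * d ^ 2 * x) * N ^ 2"
    unfolding quadratic_def by (simp add: algebra_simps power2_eq_square)
  also have "d' * \<dots> = x ^ 2 * e * P"
    unfolding TN unfolding M_def N_def P_def e_def t
    by (simp add: algebra_simps power2_eq_square)
  finally show ?thesis
    unfolding P[symmetric] N_def e_def by (simp add: power2_eq_square power3_eq_cube mult_ac)
qed

text \<open>
  The hypotheses pass from \<open>c\<close> to the shifted sequence \<open>n \<mapsto> c (n + 2)\<close>. Induction on \<open>n\<close> for all
  such \<open>c\<close> at once therefore applies to the tail of the fraction, and \<open>quadratic_shift\<close> carries
  the divisibility back to the whole fraction, raising the exponent by \<open>2\<close>.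
\<close>

lemma X_power_dvd_quadratic_cfrac:
  fixes c :: "nat \<Rightarrow> 'a :: field" and t :: 'a
  assumes "\<And>k. c (2 * k + 3) * (c (2 * k + 1) * c (2 * k + 2)) = 1"
    and "\<And>k. c (2 * k + 2) * c (2 * k + 4) = t + c (2 * k + 1) * c (2 * k + 2)"
    and "\<And>k. c (2 * k + 2) \<noteq> 0"
  shows "fps_X ^ (2 * n) dvd
    quadratic (fps_const (c 1)) (fps_const (c 2)) (fps_const t) fps_X (cfrac c)"
  using assms
proof (induction n arbitrary: c)
  case 0
  show ?case by simp
next
  case (Suc n)
  let ?c = "\<lambda>n. c (n + 2)"
  let ?Q = "quadratic (fps_const (c 1)) (fps_const (c 2)) (fps_const t) fps_X (cfrac c)"
  let ?Q' = "quadratic (fps_const (c 3)) (fps_const (c 4)) (fps_const t) fps_X (cfrac ?c)"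
  define U where "U = fps_const (c 4) *
    (1 - fps_const (c 1) * fps_X - fps_const (c 2) * fps_X * cfrac ?c) ^ 2"
  have "fps_X ^ (2 * n) dvd
      quadratic (fps_const (?c 1)) (fps_const (?c 2)) (fps_const t) fps_X (cfrac ?c)"
  proof (rule Suc.IH)
    fix k
    show "?c (2 * k + 3) * (?c (2 * k + 1) * ?c (2 * k + 2)) = 1"
      using Suc.prems(1)[of "Suc k"] by (simp add: eval_nat_numeral)
    show "?c (2 * k + 2) * ?c (2 * k + 4) = t + ?c (2 * k + 1) * ?c (2 * k + 2)"
      using Suc.prems(2)[of "Suc k"] by (simp add: eval_nat_numeral)
    show "?c (2 * k + 2) \<noteq> 0"
      using Suc.prems(3)[of "Suc k"] by (simp add: eval_nat_numeral)
  qed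
  then have IH: "fps_X ^ (2 * n) dvd ?Q'" by (simp add: eval_nat_numeral)
  have "U * ?Q = (fps_const (c 1) * fps_const (c 2)) ^ 3 * fps_X ^ 2 * ?Q'"
    unfolding U_def
  proof (rule quadratic_shift)
    show "fps_const (c 3) * (fps_const (c 1) * fps_const (c 2)) = 1"
      using Suc.prems(1)[of 0] by (simp add: numeral_2_eq_2)
    show "fps_const (c 2) * fps_const (c 4) = fps_const t + fps_const (c 1) * fps_const (c 2)"
      using Suc.prems(2)[of 0] by (simp add: numeral_2_eq_2)
  qed (rule cfrac_unfold_twice)
  moreover have "fps_X ^ (2 * Suc n) dvd
      (fps_const (c 1) * fps_const (c 2)) ^ 3 * fps_X ^ 2 * ?Q'"
    using dvd_mult[OF mult_dvd_mono[OF dvd_refl[of "fps_X ^ 2"] IH]]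
    by (simp add: power2_eq_square mult.assoc)
  ultimately have "fps_X ^ (2 * Suc n) dvd U * ?Q" by (simp only:)
  moreover have "is_unit U"
  proof -
    have "fps_nth U 0 = c 4"
      by (simp add: U_def fps_nth_power_0 mult.assoc)
    then show ?thesis using Suc.prems(3)[of 1] by simp
  qed
  ultimately show ?case by (simp only: dvd_mult_unit_iff')
qed

lemma fps_eq_0_if_X_powers_dvd:
  fixes f :: "'a :: field fps"
  assumes "\<And>n. fps_X ^ (2 * n) dvd f"
  shows "f = 0"
proof (rule fps_ext)
  fix n
  obtain g where "f = fps_X ^ (2 * Suc n) * g" using assms[of "Suc n"] by (auto elim: dvdE)
  then show "fps_nth f n = fps_nth 0 n"
    by (simp add: fps_X_power_mult_nth mult.assoc del: power_Suc)
qed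

theorem proposition1:
  fixes b d t :: ratfun3 and T :: "ratfun3 fps"
  defines "b \<equiv> ind_b" and "d \<equiv> ind_d" and "t \<equiv> ind_t" and "T \<equiv> cfrac dseq"
  defines "\<A> \<equiv> fps_const (b * t + 1) * fps_X - fps_const (b * ((b + d) * t + 1)) * fps_X ^ 2"
      and "\<B> \<equiv> fps_const (b * d * t) * fps_X ^ 2
               + fps_const (- b * t + b ^ 2 * d + d ^ 2 * b - 1) * fps_X - fps_const (b * d)"
      and "\<C> \<equiv> fps_const (b * d) - fps_const (b * d ^ 2) * fps_X"
  shows "fps_nth T 0 = 1 \<and> \<A> * T ^ 2 + \<B> * T + \<C> = 0"
proof -
  have odd: "dseq (2 * k + 3) * (dseq (2 * k + 1) * dseq (2 * k + 2)) = 1" for k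
  proof -
    have "dseq (2 * k + 3) = 1 / (dseq (2 * k + 2) * dseq (2 * k + 1))"
      using dseq_odd[of "2 * k + 3"] by simp
    then show ?thesis by (simp add: dseq_nonzero)
  qed
  have even: "dseq (2 * k + 2) * dseq (2 * k + 4) = t + dseq (2 * k + 1) * dseq (2 * k + 2)" for k
  proof -
    have "dseq (2 * k + 4) = t / dseq (2 * k + 2) + dseq (2 * k + 1)"
      using dseq_even[of "2 * k + 4"] by (simp add: t_def)
    then show ?thesis by (simp add: dseq_nonzero distrib_left mult.commute)
  qed
  have "quadratic (fps_const (dseq 1)) (fps_const (dseq 2)) (fps_const t) fps_X (cfrac dseq) = 0"
    by (intro fps_eq_0_if_X_powers_dvd X_power_dvd_quadratic_cfrac odd even)
       (simp add: dseq_nonzero)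
  then have Q: "quadratic (fps_const b) (fps_const d) (fps_const t) fps_X T = 0"
    by (simp only: dseq_1 dseq_2 b_def d_def T_def)
  have "\<A> * T ^ 2 + \<B> * T + \<C> =
      quadratic (fps_const b) (fps_const d) (fps_const t) fps_X T"
    unfolding quadratic_def \<A>_def \<B>_def \<C>_def
    by (simp flip: fps_const_add fps_const_mult fps_const_power fps_const_sub fps_const_neg)
  with Q show ?thesis by (simp add: T_def fps_nth_cfrac_0)
qed

end
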